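(* Let $\mathbb F\in\{\mathbb C,\mathbb R\}$, let $R=\mathbb C[x_1,\dots,x_n]$, and let $A\in R^{\ell\times k}$ be a row-homogeneous polynomial matrix of $\mathbb F$-constant rank. Then the syzygy matrix $S$ of $A$ has the property $$\ker_{\mathbb C}A(\xi)=\operatorname{im}_{\mathbb C}S(\xi)\quad\text{for all }\xi\in\mathbb F^n\setminus\{0\}.$$
   Context: A syzygy matrix $S$ of $A$ is a matrix over $R$ whose columns generate $\ker_R A=\{u\in R^k:Au=0\}$. Row-homogeneous: for each row index $i$ there is an integer $d_i$ such that $A_{ij}$ is homogeneous of degree $d_i$ for every $j$. $\mathbb F$-constant rank: $\operatorname{rank}_{\mathbb C}A(\xi)$ is the same for all $\xi\in\mathbb F^n\setminus\{0\}$. *)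

theory Defs
  imports
    Complex_Main
    "HOL-Library.Poly_Mapping"
    "Jordan_Normal_Form.Matrix_Kernel"
    "Jordan_Normal_Form.DL_Rank"
begin

text \<open>The ring \<open>R = \<complex>[x\<^sub>1, \<dots>, x\<^sub>n]\<close>, with the indeterminates indexed by the finite type
  \<open>'n\<close>, \<open>n = CARD('n)\<close>: finitely supported maps from exponent vectors to coefficients. The
  library's multiplication on this type is convolution, that is, multiplication of polynomials.\<close>

type_synonym 'n cpoly = "('n \<Rightarrow>\<^sub>0 nat) \<Rightarrow>\<^sub>0 complex"

definition poly_eval :: "('n::finite \<Rightarrow> complex) \<Rightarrow> 'n cpoly \<Rightarrow> complex" where
  "poly_eval \<xi> p =
     (\<Sum>m\<in>Poly_Mapping.keys p. Poly_Mapping.lookup p m * (\<Prod>i\<in>UNIV. \<xi> i ^ Poly_Mapping.lookup m i))"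

text \<open>The zero polynomial is homogeneous of every integer degree, and it is the only
  polynomial homogeneous of a negative degree.\<close>

definition homogeneous :: "int \<Rightarrow> 'n::finite cpoly \<Rightarrow> bool" where
  "homogeneous d p \<longleftrightarrow>
     (\<forall>m\<in>Poly_Mapping.keys p. int (\<Sum>i\<in>UNIV. Poly_Mapping.lookup m i) = d)"

definition row_homogeneous :: "'n::finite cpoly mat \<Rightarrow> bool" where
  "row_homogeneous A \<longleftrightarrow>
     (\<forall>i<dim_row A. \<exists>d. \<forall>j<dim_col A. homogeneous d (A $$ (i, j)))"

definition mat_eval :: "('n::finite \<Rightarrow> complex) \<Rightarrow> 'n cpoly mat \<Rightarrow> complex mat" where
  "mat_eval \<xi> A = map_mat (poly_eval \<xi>) A"

text \<open>\<open>nonzero_points F\<close> is \<open>F\<^sup>n - {0}\<close>, as a subset of \<open>\<complex>\<^sup>n\<close>; the real case is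
  \<open>F = \<real>\<close>, the set of real numbers inside \<open>\<complex>\<close>.\<close>

definition nonzero_points :: "complex set \<Rightarrow> ('n::finite \<Rightarrow> complex) set" where
  "nonzero_points F = {\<xi>. (\<forall>i. \<xi> i \<in> F) \<and> \<xi> \<noteq> (\<lambda>_. 0)}"

definition constant_rank :: "complex set \<Rightarrow> 'n::finite cpoly mat \<Rightarrow> bool" where
  "constant_rank F A \<longleftrightarrow>
     (\<exists>r. \<forall>\<xi>\<in>nonzero_points F. vec_space.rank (dim_row A) (mat_eval \<xi> A) = r)"

text \<open>The columns of \<open>S\<close> generate \<open>{u \<in> R\<^sup>k. A u = 0}\<close> as an \<open>R\<close>-module, where
  \<open>k = dim_col A\<close>. The number of columns of \<open>S\<close> is arbitrary, possibly zero.\<close>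

definition syzygy_matrix :: "'n::finite cpoly mat \<Rightarrow> 'n cpoly mat \<Rightarrow> bool" where
  "syzygy_matrix A S \<longleftrightarrow>
     dim_row S = dim_col A \<and>
     LinearCombinations.module.span class_ring (module_vec TYPE('n cpoly) (dim_col A)) (set (cols S))
       = mat_kernel A"

definition mat_image :: "'a::semiring_0 mat \<Rightarrow> 'a vec set" where
  "mat_image M = {M *\<^sub>v v | v. v \<in> carrier_vec (dim_col M)}"

end

theory Submission
  imports Defs
begin

text \<open>
  The columns of \<open>S\<close> lie in the kernel of \<open>A\<close>, so \<open>A S = 0\<close>; evaluating at \<open>\<xi>\<close> gives the
  inclusion of the image in the kernel. The point is the other inclusion: every complex vector \<open>v\<close>
  with \<open>A(\<xi>) v = 0\<close> must be the value at \<open>\<xi>\<close> of a polynomial solution \<open>u\<close> of \<open>A u = 0\<close>. Such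
  a \<open>u\<close> is a combination \<open>S y\<close> of syzygies, and so \<open>v = S(\<xi>) y(\<xi>)\<close>.

  Let \<open>r\<close> be the constant rank. There are complex matrices \<open>P\<close> and \<open>Q\<close> such that
  \<open>P A(\<xi>) Q\<close> is the \<open>r \<times> r\<close> identity (lemma \<open>rank_compression\<close>). Put \<open>M = P A Q\<close>, a
  polynomial matrix of size \<open>r \<times> r\<close> with \<open>M(\<xi>) = 1\<close>, and
    \<open>u = (det M) v - Q (adj M) P A v\<close>.
  Then \<open>P A u = (det M) P A v - M (adj M) P A v = 0\<close>, and \<open>u(\<xi>) = v\<close> because \<open>A(\<xi>) v = 0\<close>
  and \<open>det M(\<xi>) = 1\<close>.

  To pass from \<open>P A u = 0\<close> to \<open>A u = 0\<close>, evaluate at a point \<open>\<eta>\<close> with nonzero real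
  coordinates at which \<open>det M(\<eta>) \<noteq> 0\<close>. As \<open>A(\<eta>)\<close> has rank \<open>r\<close> as well, \<open>P\<close> is injective on its
  column space (lemma \<open>mult_eq_zero_of_nonsingular_compression\<close>), so \<open>A(\<eta>) u(\<eta>) = 0\<close>. Hence
  \<open>det M\<close> times any entry of \<open>A u\<close> vanishes at every point with nonzero real coordinates, and
  this forces one of the two polynomials to be zero (lemma \<open>zero_factor_if_product_vanishes\<close>).
  It is not \<open>det M\<close>, whose value at \<open>\<xi>\<close> is 1. Only real points \<open>\<eta>\<close> are tested, so the real
  and the complex case are treated together.
\<close>

section \<open>Evaluation as a ring homomorphism\<close>

lemma poly_eval_eq_sum:
  assumes "finite K" "Poly_Mapping.keys p \<subseteq> K"
  shows "poly_eval \<xi> p =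
    (\<Sum>m\<in>K. Poly_Mapping.lookup p m * (\<Prod>i\<in>UNIV. \<xi> i ^ Poly_Mapping.lookup m i))"
  unfolding poly_eval_def using assms
  by (intro sum.mono_neutral_left) (auto simp: in_keys_iff)

lemma poly_eval_zero: "poly_eval \<xi> 0 = 0"
  by (simp add: poly_eval_def)

lemma poly_eval_one: "poly_eval \<xi> 1 = 1"
  by (simp add: poly_eval_def)

lemma poly_eval_single:
  "poly_eval \<xi> (Poly_Mapping.single m c) = c * (\<Prod>i\<in>UNIV. \<xi> i ^ Poly_Mapping.lookup m i)"
  by (simp add: poly_eval_eq_sum[of "{m}"])

lemma poly_eval_add: "poly_eval \<xi> (p + q) = poly_eval \<xi> p + poly_eval \<xi> q"
proof -
  let ?K = "Poly_Mapping.keys p \<union> Poly_Mapping.keys q"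
  have "Poly_Mapping.keys (p + q) \<subseteq> ?K" by (rule Poly_Mapping.keys_add)
  then show ?thesis
    by (simp add: poly_eval_eq_sum[of ?K] lookup_add distrib_right sum.distrib)
qed

lemma poly_eval_sum: "poly_eval \<xi> (\<Sum>a\<in>I. f a) = (\<Sum>a\<in>I. poly_eval \<xi> (f a))"
  by (induction I rule: infinite_finite_induct) (simp_all add: poly_eval_zero poly_eval_add)

lemma sum_monomials: "(\<Sum>m\<in>Poly_Mapping.keys p. Poly_Mapping.single m (Poly_Mapping.lookup p m)) = p"
  by (rule poly_mapping_eqI)
     (auto simp: lookup_sum lookup_single when_def in_keys_iff)

lemma poly_eval_mult: "poly_eval \<xi> (p * q) = poly_eval \<xi> p * poly_eval \<xi> q"
proof -
  let ?s = "\<lambda>p m. Poly_Mapping.single m (Poly_Mapping.lookup p m)"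
  have single: "poly_eval \<xi> (?s p m * ?s q m') = poly_eval \<xi> (?s p m) * poly_eval \<xi> (?s q m')" for m m'
    by (simp add: mult_single poly_eval_single lookup_add power_add prod.distrib)
  have "poly_eval \<xi> ((\<Sum>m\<in>Poly_Mapping.keys p. ?s p m) * (\<Sum>m\<in>Poly_Mapping.keys q. ?s q m))
    = poly_eval \<xi> (\<Sum>m\<in>Poly_Mapping.keys p. ?s p m) * poly_eval \<xi> (\<Sum>m\<in>Poly_Mapping.keys q. ?s q m)"
    by (simp add: sum_product poly_eval_sum single)
  then show ?thesis by (simp add: sum_monomials)
qed

interpretation poly_eval: comm_ring_hom "poly_eval \<xi>"
  by standard (simp_all add: poly_eval_zero poly_eval_one poly_eval_add poly_eval_mult)

section \<open>Polynomials vanishing at all real points\<close>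

lemma digits_unique:
  fixes f g :: "nat \<Rightarrow> nat"
  assumes "\<And>i. i < n \<Longrightarrow> f i < B" "\<And>i. i < n \<Longrightarrow> g i < B"
    and "(\<Sum>i<n. f i * B ^ i) = (\<Sum>i<n. g i * B ^ i)" "i < n"
  shows "f i = g i"
  using assms
proof (induction n arbitrary: f g i)
  case (Suc n)
  have split: "(\<Sum>i<Suc n. h i * B ^ i) = h 0 + B * (\<Sum>i<n. h (Suc i) * B ^ i)" for h
    by (simp only: sum.lessThan_Suc_shift) (simp add: sum_distrib_left algebra_simps)
  have eq: "f 0 + B * (\<Sum>i<n. f (Suc i) * B ^ i) = g 0 + B * (\<Sum>i<n. g (Suc i) * B ^ i)"
    using Suc.prems(3) by (simp only: split)
  have B: "f 0 < B" "g 0 < B" using Suc.prems(1,2) by auto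
  have "f 0 = g 0" using arg_cong[OF eq, of "\<lambda>x. x mod B"] B by simp
  moreover have "(\<Sum>i<n. f (Suc i) * B ^ i) = (\<Sum>i<n. g (Suc i) * B ^ i)"
    using arg_cong[OF eq, of "\<lambda>x. x div B"] B by simp
  then have "f (Suc j) = g (Suc j)" if "j < n" for j
    using Suc.IH[of "\<lambda>i. f (Suc i)" "\<lambda>i. g (Suc i)" j] Suc.prems(1,2) that by simp
  ultimately show ?case using Suc.prems(4) by (cases i) simp_all
qed simp

text \<open>Kronecker substitution: number the variables \<open>0, \<dots>, n - 1\<close> and give the variable with
  number \<open>j\<close> the weight \<open>B\<^sup>j\<close>, where \<open>B\<close> exceeds every exponent that occurs in \<open>K\<close>. The
  weight of a monomial then has the exponents of the monomial as its base-\<open>B\<close> digits, so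
  different monomials have different weights.\<close>

lemma ex_separating_weights:
  fixes K :: "('n::finite \<Rightarrow>\<^sub>0 nat) set"
  assumes "finite K"
  obtains w :: "'n \<Rightarrow> nat"
    where "inj_on (\<lambda>m. \<Sum>i\<in>UNIV. Poly_Mapping.lookup m i * w i) K"
proof -
  obtain e :: "'n \<Rightarrow> nat" where e: "bij_betw e UNIV {..<card (UNIV :: 'n set)}"
    using ex_bij_betw_finite_nat[of "UNIV :: 'n set"] by (auto simp: atLeast0LessThan)
  define d where "d = inv_into UNIV e"
  have d: "bij_betw d {..<card (UNIV :: 'n set)} UNIV"
    unfolding d_def by (rule bij_betw_inv_into[OF e])
  have ed: "e (d j) = j" if "j < card (UNIV :: 'n set)" for j
    unfolding d_def using bij_betw_inv_into_right[OF e] that by simp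
  have de: "d (e i) = i" and e_less: "e i < card (UNIV :: 'n set)" for i
    using bij_betw_inv_into_left[OF e] bij_betwE[OF e] by (auto simp: d_def)
  define V where "V = (\<Union>m\<in>K. Poly_Mapping.lookup m ` UNIV)"
  have "finite V" unfolding V_def using assms by auto
  then obtain B where B: "\<forall>v\<in>V. v < B"
    using finite_nat_set_iff_bounded by blast
  show ?thesis
  proof (rule that[of "\<lambda>i. B ^ e i"], rule inj_onI)
    fix m m' assume m: "m \<in> K" "m' \<in> K"
      and eq: "(\<Sum>i\<in>UNIV. Poly_Mapping.lookup m i * B ^ e i) = (\<Sum>i\<in>UNIV. Poly_Mapping.lookup m' i * B ^ e i)"
    have reindex: "(\<Sum>i\<in>UNIV. Poly_Mapping.lookup m i * B ^ e i)
      = (\<Sum>j<card (UNIV :: 'n set). Poly_Mapping.lookup m (d j) * B ^ j)" for m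
      unfolding sum.reindex_bij_betw[OF d, symmetric] by (simp add: ed)
    have "Poly_Mapping.lookup m i = Poly_Mapping.lookup m' i" for i
      using digits_unique[of "card (UNIV :: 'n set)" "\<lambda>j. Poly_Mapping.lookup m (d j)" B
          "\<lambda>j. Poly_Mapping.lookup m' (d j)" "e i"] eq B m
      by (auto simp: reindex e_less de V_def)
    then show "m = m'" by (rule poly_mapping_eqI)
  qed
qed

text \<open>The pullback of \<open>p\<close> along the curve \<open>t \<mapsto> (t\<^bsup>w i\<^esup>)\<^sub>i\<close>, written as a sum of monomials so
  that, for weights that separate the monomials of \<open>p\<close>, its coefficients are those of \<open>p\<close>.\<close>

definition on_monomial_curve :: "('n::finite \<Rightarrow> nat) \<Rightarrow> 'n cpoly \<Rightarrow> complex poly" where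
  "on_monomial_curve w p = (\<Sum>m\<in>Poly_Mapping.keys p.
     monom (Poly_Mapping.lookup p m) (\<Sum>i\<in>UNIV. Poly_Mapping.lookup m i * w i))"

lemma poly_on_monomial_curve: "poly (on_monomial_curve w p) t = poly_eval (\<lambda>i. t ^ w i) p"
proof -
  have "t ^ (\<Sum>i\<in>UNIV. Poly_Mapping.lookup m i * w i) = (\<Prod>i\<in>UNIV. (t ^ w i) ^ Poly_Mapping.lookup m i)"
    for m :: "'a \<Rightarrow>\<^sub>0 nat"
    unfolding power_sum by (simp add: power_mult[symmetric] mult.commute)
  then show ?thesis by (simp add: on_monomial_curve_def poly_eval_def poly_sum poly_monom)
qed

lemma on_monomial_curve_nonzero:
  assumes "inj_on (\<lambda>m. \<Sum>i\<in>UNIV. Poly_Mapping.lookup m i * w i) (Poly_Mapping.keys p)" "p \<noteq> 0"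
  shows "on_monomial_curve w p \<noteq> 0"
proof -
  let ?W = "\<lambda>m. \<Sum>i\<in>UNIV. Poly_Mapping.lookup m i * w i"
  obtain m where m: "m \<in> Poly_Mapping.keys p" using assms(2) by fastforce
  have "coeff (on_monomial_curve w p) (?W m)
      = (\<Sum>m'\<in>Poly_Mapping.keys p. if m' = m then Poly_Mapping.lookup p m' else 0)"
    unfolding on_monomial_curve_def coeff_sum coeff_monom
    by (rule sum.cong[OF refl]) (use inj_onD[OF assms(1)] m in auto)
  also have "\<dots> = Poly_Mapping.lookup p m" using m by simp
  finally show ?thesis using m by (auto simp: in_keys_iff)
qed

text \<open>Here the density of the real points enters: along a monomial curve whose weights separate
  the monomials of both factors, nonzero factors become nonzero polynomials in one variable, and
  their product has only finitely many zeros. All points of the curve with \<open>t \<ge> 1\<close> have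
  nonzero real coordinates, so they are among the points at which the product is known to
  vanish. Treating two factors at once reduces the absence of zero divisors to the case of one
  variable.\<close>

lemma zero_factor_if_product_vanishes:
  fixes p q :: "'n::finite cpoly"
  assumes van: "\<And>\<eta>. (\<And>i. \<eta> i \<in> \<real>) \<Longrightarrow> (\<And>i. \<eta> i \<noteq> 0) \<Longrightarrow> poly_eval \<eta> p * poly_eval \<eta> q = 0"
  shows "p = 0 \<or> q = 0"
proof (rule ccontr)
  assume neq: "\<not> (p = 0 \<or> q = 0)"
  obtain w where w: "inj_on (\<lambda>m. \<Sum>i\<in>UNIV. Poly_Mapping.lookup m i * w i)
      (Poly_Mapping.keys p \<union> Poly_Mapping.keys q)"
    by (rule ex_separating_weights[of "Poly_Mapping.keys p \<union> Poly_Mapping.keys q"]) auto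
  have nz: "on_monomial_curve w p * on_monomial_curve w q \<noteq> 0"
    using neq inj_on_subset[OF w, of "Poly_Mapping.keys p"] inj_on_subset[OF w, of "Poly_Mapping.keys q"]
    by (simp add: on_monomial_curve_nonzero)
  have "poly (on_monomial_curve w p * on_monomial_curve w q) (complex_of_real t) = 0" if "t \<ge> 1" for t
    using van[of "\<lambda>i. complex_of_real t ^ w i"] that by (simp add: poly_on_monomial_curve)
  then have "complex_of_real ` {1..} \<subseteq> {t. poly (on_monomial_curve w p * on_monomial_curve w q) t = 0}"
    by auto
  then have "finite (complex_of_real ` {1..})"
    using poly_roots_finite[OF nz] finite_subset by blast
  then have "finite {1::real..}"
    by (rule finite_imageD) (auto simp: inj_on_def)
  then show False using infinite_Ici by blast
qed

section \<open>Matrices of prescribed rank\<close>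

lemma mult_mat_zero_vec: "A \<in> carrier_mat l k \<Longrightarrow> A *\<^sub>v 0\<^sub>v k = 0\<^sub>v l"
  by auto

lemma mult_mat_vec_smult:
  fixes A :: "'a::comm_semiring_0 mat"
  assumes "A \<in> carrier_mat l k" "v \<in> carrier_vec k"
  shows "A *\<^sub>v (c \<cdot>\<^sub>v v) = c \<cdot>\<^sub>v (A *\<^sub>v v)"
  using assms
  by (intro eq_vecI) (simp_all add: scalar_prod_def sum_distrib_left mult.left_commute)

lemma (in vec_module) span_cols_subset_image:
  assumes S: "S \<in> carrier_mat n m" and u: "u \<in> span (set (cols S))"
  obtains y where "y \<in> carrier_vec m" "u = S *\<^sub>v y"
proof -
  have cols: "set (cols S) \<subseteq> carrier_vec n" using cols_dim S by blast
  obtain a where "u = lincomb a (set (cols S))"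
    using u finite_span[OF _ cols] by auto
  \<comment> \<open>A column that occurs repeatedly in \<open>S\<close> is a single element of the set, so its coefficient
    is assigned to its first occurrence only.\<close>
  also have "\<dots> = S *\<^sub>v vec m (\<lambda>i. if \<exists>j<i. cols S ! i = cols S ! j then 0 else a (cols S ! i))"
    using S cols by (subst lincomb_as_lincomb_list[OF cols], subst lincomb_list_as_mat_mult) auto
  finally show ?thesis by (rule that[rotated]) simp
qed

lemma factor_if_cols_in_image:
  assumes S: "S \<in> carrier_mat n m" and A: "A \<in> carrier_mat n k"
    and cols: "\<And>j. j < k \<Longrightarrow> \<exists>y\<in>carrier_vec m. col A j = S *\<^sub>v y"
  obtains Y where "Y \<in> carrier_mat m k" "A = S * Y"
proof -
  obtain y where y: "\<And>j. j < k \<Longrightarrow> y j \<in> carrier_vec m" "\<And>j. j < k \<Longrightarrow> col A j = S *\<^sub>v y j"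
    using cols by metis
  define Y where "Y = mat_of_cols m (map y [0..<k])"
  have Y: "Y \<in> carrier_mat m k" unfolding Y_def using mat_of_cols_carrier(1)[of m "map y [0..<k]"] by simp
  have "A = S * Y"
  proof (rule mat_col_eqI)
    fix j assume "j < dim_col (S * Y)"
    then have j: "j < k" using Y by simp
    have "col Y j = y j" unfolding Y_def using j y(1) by (subst col_mat_of_cols) auto
    then show "col A j = col (S * Y) j" using j y(2) S Y by (simp add: mult_mat_vec_def)
  qed (use A S Y in auto)
  with Y show ?thesis by (rule that)
qed

text \<open>The columns of \<open>T\<close> are a maximal independent set of columns of \<open>A\<close>: each is a column of
  \<open>A\<close>, whence \<open>Q\<close>, and together they span all columns of \<open>A\<close>, whence \<open>Y\<close>.
  Their independence is the triviality of the kernel of \<open>T\<close>.\<close>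

lemma rank_factorization:
  fixes A :: "'a::field mat"
  assumes A: "A \<in> carrier_mat l k" and r: "vec_space.rank l A = r"
  obtains T Y Q where "T \<in> carrier_mat l r" "Y \<in> carrier_mat r k" "Q \<in> carrier_mat k r"
    "A = T * Y" "T = A * Q" "mat_kernel T = {0\<^sub>v r}"
proof -
  interpret vec_space "TYPE('a)" l .
  have cols: "set (cols A) \<subseteq> carrier_vec l" using cols_dim A by blast
  have "lin_indpt {}" by (auto simp: lin_dep_def)
  then obtain U where U: "maximal U (\<lambda>T. T \<subseteq> set (cols A) \<and> lin_indpt T)" "finite U"
    using maximal_exists_superset[of "set (cols A)" "\<lambda>T. T \<subseteq> set (cols A) \<and> lin_indpt T" "{}"] by auto
  have Ucols: "U \<subseteq> set (cols A)" and indpt: "lin_indpt U"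
    using U(1) by (auto simp: maximal_def)
  have Uc: "U \<subseteq> carrier_vec l" using Ucols cols by blast
  have cardU: "card U = r" using rank_card_indpt[OF A U(1)] r by simp
  obtain xs where xs: "set xs = U" "distinct xs" using finite_distinct_list[OF U(2)] by blast
  have len: "length xs = r" using distinct_card[OF xs(2)] xs(1) cardU by simp
  define T where "T = mat_of_cols l xs"
  have T: "T \<in> carrier_mat l r" unfolding T_def using mat_of_cols_carrier(1)[of l xs] len by simp
  have colsT: "cols T = xs" unfolding T_def using Uc xs(1) by simp
  have spans: "x \<in> span U" if "x \<in> set (cols A)" for x
  proof (rule ccontr)
    assume x: "x \<notin> span U"
    then have "x \<notin> U" using in_own_span[OF Uc] by blast
    have "lin_indpt (insert x U)"
      using lin_dep_iff_in_span[OF Uc indpt _ \<open>x \<notin> U\<close>] x that cols by auto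
    then have "insert x U = U"
      using U(1) that Ucols unfolding maximal_def by blast
    then show False using \<open>x \<notin> U\<close> by blast
  qed
  obtain Y where Y: "Y \<in> carrier_mat r k" "A = T * Y"
  proof (rule factor_if_cols_in_image[OF T A])
    fix j assume j: "j < k"
    have "col A j \<in> set (cols A)" using j A by (auto simp: cols_def)
    then have "col A j \<in> span (set (cols T))" using spans by (simp add: colsT xs)
    then show "\<exists>y\<in>carrier_vec r. col A j = T *\<^sub>v y"
      by (rule span_cols_subset_image[OF T]) blast
  qed
  obtain Q where Q: "Q \<in> carrier_mat k r" "T = A * Q"
  proof (rule factor_if_cols_in_image[OF A T])
    fix j assume j: "j < r"
    have "col T j \<in> set (cols T)" using j T by (auto simp: cols_def)
    then have "col T j \<in> set (cols A)" using Ucols by (auto simp: colsT xs)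
    then obtain i where i: "i < k" "col T j = col A i" using A by (auto simp: cols_def)
    then have "col T j = A *\<^sub>v unit_vec k i" using A by (intro eq_vecI) simp_all
    then show "\<exists>y\<in>carrier_vec k. col T j = A *\<^sub>v y" by auto
  qed
  have "mat_kernel T = {0\<^sub>v r}"
  proof
    show "mat_kernel T \<subseteq> {0\<^sub>v r}"
    proof
      fix v assume v: "v \<in> mat_kernel T"
      have "\<not> lin_dep (set (cols T))" using indpt by (simp add: colsT xs)
      then have "v = 0\<^sub>v r"
        using lin_depI[OF T, of v] mat_kernelD[OF T v] xs(2) by (auto simp: colsT)
      then show "v \<in> {0\<^sub>v r}" by simp
    qed
    show "{0\<^sub>v r} \<subseteq> mat_kernel T" using T by (auto simp: mat_kernel[OF T])
  qed
  then show ?thesis using that T Y Q by blast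
qed

text \<open>With \<open>T\<^sup>*\<close> the conjugate transpose, \<open>(T\<^sup>* T)\<^sup>-\<^sup>1 T\<^sup>*\<close> is a left inverse. The Gram matrix
  \<open>T\<^sup>* T\<close> is invertible, since \<open>T\<^sup>* T v = 0\<close> gives \<open>\<parallel>T v\<parallel>\<^sup>2 = 0\<close> and so \<open>T v = 0\<close>.\<close>

lemma injective_imp_left_inverse:
  fixes T :: "complex mat"
  assumes T: "T \<in> carrier_mat l r" and ker: "mat_kernel T = {0\<^sub>v r}"
  obtains P where "P \<in> carrier_mat r l" "P * T = 1\<^sub>m r"
proof -
  define H where "H = mat r l (\<lambda>(i, j). cnj (T $$ (j, i)))"
  have H: "H \<in> carrier_mat r l" by (simp add: H_def)
  have "det (H * T) \<noteq> 0"
  proof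
    assume "det (H * T) = 0"
    then obtain v where v: "v \<in> carrier_vec r" "v \<noteq> 0\<^sub>v r" "H * T *\<^sub>v v = 0\<^sub>v r"
      using det_0_iff_vec_prod_zero_field[of "H * T" r] H T by auto
    define w where "w = T *\<^sub>v v"
    have w: "w \<in> carrier_vec l" using T v by (simp add: w_def)
    have Hw: "H *\<^sub>v w = 0\<^sub>v r" using v H T by (simp add: w_def)
    have "w \<bullet>c w = (\<Sum>j<l. (\<Sum>i<r. T $$ (j, i) * v $ i) * cnj (w $ j))"
      using T v w by (simp add: scalar_prod_def w_def atLeast0LessThan row_def)
    also have "\<dots> = (\<Sum>i<r. v $ i * cnj (\<Sum>j<l. cnj (T $$ (j, i)) * w $ j))"
      by (simp add: sum_distrib_left sum_distrib_right mult_ac) (rule sum.swap)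
    also have "\<dots> = (\<Sum>i<r. v $ i * cnj ((H *\<^sub>v w) $ i))"
      using w by (simp add: H_def scalar_prod_def row_def atLeast0LessThan)
    also have "\<dots> = 0" by (simp add: Hw)
    finally have "w = 0\<^sub>v l" using w by simp
    then have "v \<in> mat_kernel T" using T v by (simp add: mat_kernel[OF T] w_def)
    then show False using ker v(2) by simp
  qed
  moreover have HT: "H * T \<in> carrier_mat r r" using H T by simp
  ultimately obtain B where "B \<in> carrier_mat r r" "B * (H * T) = 1\<^sub>m r"
    using det_non_zero_imp_unit[OF HT, of "()"]
    by (auto simp: Units_def ring_mat_def)
  then have "B * H \<in> carrier_mat r l" "B * H * T = 1\<^sub>m r" using H T by auto
  then show ?thesis by (rule that)
qed

text \<open>\<open>Q\<close> selects \<open>r\<close> independent columns of \<open>A\<close>, and \<open>P\<close> is a left inverse of the matrix that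
  they form. This replaces the choice of a nonsingular \<open>r \<times> r\<close> submatrix.\<close>

lemma rank_compression:
  fixes A :: "complex mat"
  assumes A: "A \<in> carrier_mat l k" and r: "vec_space.rank l A = r"
  obtains P Q where "P \<in> carrier_mat r l" "Q \<in> carrier_mat k r" "P * A * Q = 1\<^sub>m r"
proof -
  obtain T Q where T: "T \<in> carrier_mat l r" "mat_kernel T = {0\<^sub>v r}"
    and Q: "Q \<in> carrier_mat k r" "T = A * Q"
    by (rule rank_factorization[OF A r]) blast
  obtain P where P: "P \<in> carrier_mat r l" "P * T = 1\<^sub>m r"
    by (rule injective_imp_left_inverse[OF T])
  then have "P * A * Q = 1\<^sub>m r" using A Q by (simp add: assoc_mult_mat[of _ r l _ k])
  with P(1) Q(1) show ?thesis by (rule that)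
qed

text \<open>If compressing a matrix \<open>B\<close> of rank \<open>r\<close> to size \<open>r \<times> r\<close> gives a nonsingular matrix, then
  \<open>P\<close> loses nothing on the column space of \<open>B\<close>. For \<open>B = T Y\<close> with inner dimension \<open>r\<close>, the
  compression is the product of the square matrices \<open>P T\<close> and \<open>Y Q\<close>, so \<open>P T\<close> is nonsingular.\<close>

lemma mult_eq_zero_of_nonsingular_compression:
  fixes B :: "'a::field mat"
  assumes B: "B \<in> carrier_mat l k" and r: "vec_space.rank l B = r"
    and P: "P \<in> carrier_mat r l" and Q: "Q \<in> carrier_mat k r"
    and det: "det (P * B * Q) \<noteq> 0"
    and u: "u \<in> carrier_vec k" and PBu: "P *\<^sub>v (B *\<^sub>v u) = 0\<^sub>v r"
  shows "B *\<^sub>v u = 0\<^sub>v l"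
proof -
  obtain T Y where T: "T \<in> carrier_mat l r" and Y: "Y \<in> carrier_mat r k" and BTY: "B = T * Y"
    by (rule rank_factorization[OF B r]) blast
  have PT: "P * T \<in> carrier_mat r r" and YQ: "Y * Q \<in> carrier_mat r r" using P T Y Q by auto
  have "P * B * Q = (P * T) * (Y * Q)"
    using assoc_mult_mat[OF P T Y] assoc_mult_mat[OF _ Y Q, of "P * T" r] P T by (simp add: BTY)
  then have "det (P * T) \<noteq> 0" using det by (simp add: det_mult[OF PT YQ])
  moreover have "(P * T) *\<^sub>v (Y *\<^sub>v u) = 0\<^sub>v r"
    using PBu P T Y u by (simp add: BTY)
  ultimately have "Y *\<^sub>v u = 0\<^sub>v r"
    using det_0_iff_vec_prod_zero_field[OF PT] mult_mat_vec_carrier[OF Y u] by blast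
  then show ?thesis using T Y u by (simp add: BTY mult_mat_zero_vec)
qed

section \<open>Lifting kernel vectors to syzygies\<close>

definition const_poly :: "complex \<Rightarrow> 'n::finite cpoly" where
  "const_poly c = Poly_Mapping.single 0 c"

lemma poly_eval_const_poly: "poly_eval \<xi> (const_poly c) = c"
  by (simp add: const_poly_def poly_eval_single)

lemma mat_eval_const_poly: "mat_eval \<xi> (map_mat const_poly P) = P"
  by (rule eq_matI) (simp_all add: mat_eval_def poly_eval_const_poly)

lemma vec_eval_const_poly: "map_vec (poly_eval \<xi>) (map_vec const_poly v) = v"
  by (rule eq_vecI) (simp_all add: poly_eval_const_poly)

lemma mat_eval_carrier [simp]: "mat_eval \<xi> A \<in> carrier_mat l k \<longleftrightarrow> A \<in> carrier_mat l k"
  by (auto simp: mat_eval_def)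

lemma mat_eval_zero: "mat_eval \<xi> (0\<^sub>m l k) = 0\<^sub>m l k"
  by (rule eq_matI) (simp_all add: mat_eval_def poly_eval_zero)

lemma mat_eval_mult:
  assumes "A \<in> carrier_mat l k" "B \<in> carrier_mat k m"
  shows "mat_eval \<xi> (A * B) = mat_eval \<xi> A * mat_eval \<xi> B"
  unfolding mat_eval_def by (rule poly_eval.mat_hom_mult[OF assms])

lemma vec_eval_mult:
  assumes "A \<in> carrier_mat l k" "u \<in> carrier_vec k"
  shows "map_vec (poly_eval \<xi>) (A *\<^sub>v u) = mat_eval \<xi> A *\<^sub>v map_vec (poly_eval \<xi>) u"
  unfolding mat_eval_def by (rule poly_eval.mult_mat_vec_hom[OF assms])

lemma poly_eval_det: "poly_eval \<xi> (det M) = det (mat_eval \<xi> M)"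
  by (simp add: mat_eval_def)

text \<open>The heart of the proof. Cramer's rule for the compressed matrix \<open>M = P A Q\<close> corrects the
  constant vector \<open>v\<close>, after scaling by \<open>det M\<close>, to a polynomial vector \<open>u\<close> with \<open>P A u = 0\<close>.
  Since \<open>A v\<close> vanishes at \<open>\<xi>\<close> and \<open>M\<close> is the identity there, the correction vanishes at \<open>\<xi>\<close>
  and the scaling factor is 1. Constancy of the rank turns \<open>P A u = 0\<close> into \<open>A u = 0\<close> at the
  points where \<open>det M \<noteq> 0\<close>; at the others \<open>det M \<cdot> A u\<close> vanishes anyway.\<close>

lemma kernel_vector_lifts_to_syzygy:
  fixes A :: "'n::finite cpoly mat"
  assumes A: "A \<in> carrier_mat l k" and F: "\<real> \<subseteq> F" and rank: "constant_rank F A"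
    and \<xi>: "\<xi> \<in> nonzero_points F" and v: "v \<in> mat_kernel (mat_eval \<xi> A)"
  obtains u where "u \<in> mat_kernel A" "map_vec (poly_eval \<xi>) u = v"
proof -
  obtain r where r: "\<And>\<eta>. \<eta> \<in> nonzero_points F \<Longrightarrow> vec_space.rank l (mat_eval \<eta> A) = r"
    using rank A unfolding constant_rank_def by auto
  have A\<xi>: "mat_eval \<eta> A \<in> carrier_mat l k" for \<eta> using A by simp
  have v: "v \<in> carrier_vec k" "mat_eval \<xi> A *\<^sub>v v = 0\<^sub>v l"
    using mat_kernelD[OF A\<xi> v] by auto
  obtain P Q where P: "P \<in> carrier_mat r l" and Q: "Q \<in> carrier_mat k r"
    and PAQ: "P * mat_eval \<xi> A * Q = 1\<^sub>m r"
    by (rule rank_compression[OF A\<xi> r[OF \<xi>]])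
  define P' :: "'n cpoly mat" where "P' = map_mat const_poly P"
  define Q' :: "'n cpoly mat" where "Q' = map_mat const_poly Q"
  define v' :: "'n cpoly vec" where "v' = map_vec const_poly v"
  have P': "P' \<in> carrier_mat r l" and Q': "Q' \<in> carrier_mat k r" and v': "v' \<in> carrier_vec k"
    using P Q v by (auto simp: P'_def Q'_def v'_def)
  define M where "M = P' * A * Q'"
  have M: "M \<in> carrier_mat r r" using P' A Q' by (simp add: M_def)
  have M_eval: "mat_eval \<eta> M = P * mat_eval \<eta> A * Q" for \<eta>
  proof -
    have "mat_eval \<eta> M = mat_eval \<eta> (P' * A) * mat_eval \<eta> Q'"
      unfolding M_def using P' A Q' by (intro mat_eval_mult) auto
    then show ?thesis
      by (simp add: mat_eval_mult[OF P' A]) (simp add: P'_def Q'_def mat_eval_const_poly)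
  qed
  define b where "b = P' *\<^sub>v (A *\<^sub>v v')"
  have b: "b \<in> carrier_vec r" unfolding b_def using P' A v' by (intro mult_mat_vec_carrier)
  define u where "u = det M \<cdot>\<^sub>v v' - Q' *\<^sub>v (adj_mat M *\<^sub>v b)"
  note adj = adj_mat[OF M]
  have w: "adj_mat M *\<^sub>v b \<in> carrier_vec r" using adj(1) b by simp
  have Qw: "Q' *\<^sub>v (adj_mat M *\<^sub>v b) \<in> carrier_vec k" using Q' w by simp
  have u: "u \<in> carrier_vec k" using Qw v' by (simp add: u_def)
  have PAu: "P' *\<^sub>v (A *\<^sub>v u) = 0\<^sub>v r"
  proof -
    have "P' *\<^sub>v (A *\<^sub>v u) = (P' * A) *\<^sub>v u" using P' A u by simp
    also have "\<dots> = (P' * A) *\<^sub>v (det M \<cdot>\<^sub>v v') - (P' * A) *\<^sub>v (Q' *\<^sub>v (adj_mat M *\<^sub>v b))"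
      unfolding u_def using P' A v' Qw by (intro mult_minus_distrib_mat_vec) auto
    also have "(P' * A) *\<^sub>v (det M \<cdot>\<^sub>v v') = det M \<cdot>\<^sub>v b"
      using P' A v' mult_mat_vec_smult[of "P' * A" r k v'] by (simp add: b_def)
    also have "(P' * A) *\<^sub>v (Q' *\<^sub>v (adj_mat M *\<^sub>v b)) = M *\<^sub>v (adj_mat M *\<^sub>v b)"
      unfolding M_def using P' A Q' w by (intro assoc_mult_mat_vec[symmetric]) (auto simp: M_def)
    also have "\<dots> = (M * adj_mat M) *\<^sub>v b" using M adj(1) b by simp
    also have "\<dots> = det M \<cdot>\<^sub>v b" unfolding adj(2) using b by (intro eq_vecI) simp_all
    finally show ?thesis using b by simp
  qed
  have d\<xi>: "poly_eval \<xi> (det M) = 1"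
    by (simp add: poly_eval_det M_eval PAQ)
  have u\<xi>: "map_vec (poly_eval \<xi>) u = v"
  proof -
    have "map_vec (poly_eval \<xi>) b = P *\<^sub>v (mat_eval \<xi> A *\<^sub>v v)"
      unfolding b_def using P' A v'
      by (simp add: vec_eval_mult[of _ r l] vec_eval_mult[of _ l k])
         (simp add: P'_def v'_def mat_eval_const_poly vec_eval_const_poly)
    also have "\<dots> = 0\<^sub>v r" unfolding v(2) by (rule mult_mat_zero_vec[OF P])
    finally have "map_vec (poly_eval \<xi>) b = 0\<^sub>v r" .
    then have Qw\<xi>: "map_vec (poly_eval \<xi>) (Q' *\<^sub>v (adj_mat M *\<^sub>v b)) = 0\<^sub>v k"
      using Q' w adj(1) b by (simp add: vec_eval_mult[of _ k r] vec_eval_mult[of _ r r]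
          mult_mat_zero_vec[of _ r r] mult_mat_zero_vec[of _ k r])
    show ?thesis
    proof (rule eq_vecI)
      fix i assume "i < dim_vec v"
      then have i: "i < k" using v by simp
      have "poly_eval \<xi> ((Q' *\<^sub>v (adj_mat M *\<^sub>v b)) $ i) = 0"
        using arg_cong[OF Qw\<xi>, of "\<lambda>x. x $ i"] i Q' by simp
      then show "map_vec (poly_eval \<xi>) u $ i = v $ i"
        using i v v' Q' by (simp add: u_def v'_def poly_eval.hom_minus poly_eval.hom_mult d\<xi> poly_eval_const_poly)
    qed (use u v in simp)
  qed
  have "A *\<^sub>v u = 0\<^sub>v l"
  proof (rule eq_vecI)
    fix i assume "i < dim_vec (0\<^sub>v l)"
    then have i: "i < l" by simp
    have "det M = 0 \<or> (A *\<^sub>v u) $ i = 0"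
    proof (rule zero_factor_if_product_vanishes)
      fix \<eta> :: "'n \<Rightarrow> complex" assume \<eta>: "\<And>i. \<eta> i \<in> \<real>" "\<And>i. \<eta> i \<noteq> 0"
      then have \<eta>F: "\<eta> \<in> nonzero_points F" using F by (auto simp: nonzero_points_def)
      let ?u = "map_vec (poly_eval \<eta>) u"
      have "mat_eval \<eta> A *\<^sub>v ?u = 0\<^sub>v l" if "poly_eval \<eta> (det M) \<noteq> 0"
      proof (rule mult_eq_zero_of_nonsingular_compression[OF A\<xi> r[OF \<eta>F] P Q])
        show "det (P * mat_eval \<eta> A * Q) \<noteq> 0" using that by (simp add: poly_eval_det M_eval)
        show "?u \<in> carrier_vec k" using u by simp
        have "map_vec (poly_eval \<eta>) (P' *\<^sub>v (A *\<^sub>v u)) = P *\<^sub>v (mat_eval \<eta> A *\<^sub>v ?u)"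
          using P' A u by (simp add: vec_eval_mult[of _ r l] vec_eval_mult[of _ l k])
            (simp add: P'_def mat_eval_const_poly)
        then show "P *\<^sub>v (mat_eval \<eta> A *\<^sub>v ?u) = 0\<^sub>v r"
          by (simp add: PAu poly_eval.vec_hom_zero)
      qed
      then have "map_vec (poly_eval \<eta>) (A *\<^sub>v u) = 0\<^sub>v l" if "poly_eval \<eta> (det M) \<noteq> 0"
        using that A u by (simp add: vec_eval_mult[of _ l k])
      then have "poly_eval \<eta> ((A *\<^sub>v u) $ i) = 0" if "poly_eval \<eta> (det M) \<noteq> 0"
        using that i A by (metis carrier_matD(1) dim_mult_mat_vec index_map_vec(1) index_zero_vec(1))
      then show "poly_eval \<eta> (det M) * poly_eval \<eta> ((A *\<^sub>v u) $ i) = 0" by auto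
    qed
    then show "(A *\<^sub>v u) $ i = 0\<^sub>v l $ i" using d\<xi> i by (auto simp: poly_eval_zero)
  qed (use A in simp)
  then show ?thesis using that u u\<xi> by (auto simp: mat_kernel[OF A])
qed

section \<open>The kernel of the evaluated matrix\<close>

theorem corollary4p11:
  fixes F :: "complex set"
    and A S :: "'n::finite cpoly mat"
    and \<xi> :: "'n \<Rightarrow> complex"
    and l k :: nat
  assumes "F = UNIV \<or> F = \<real>"
    and "A \<in> carrier_mat l k"
    and "row_homogeneous A"
    and "constant_rank F A"
    and "syzygy_matrix A S"
    and "\<xi> \<in> nonzero_points F"
  shows "mat_kernel (mat_eval \<xi> A) = mat_image (mat_eval \<xi> S)"
proof -
  note A = assms(2)
  interpret vec_module "TYPE('n cpoly)" k .
  define m where "m = dim_col S"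
  have S: "S \<in> carrier_mat k m" and ker: "span (set (cols S)) = mat_kernel A"
    using assms(5) A by (auto simp: syzygy_matrix_def m_def)
  have A\<xi>: "mat_eval \<xi> A \<in> carrier_mat l k" and S\<xi>: "mat_eval \<xi> S \<in> carrier_mat k m"
    using A S by auto
  have "A * S = 0\<^sub>m l m"
  proof (rule mat_col_eqI)
    fix j assume "j < dim_col (0\<^sub>m l m :: 'n cpoly mat)"
    then have j: "j < m" by simp
    have "set (cols S) \<subseteq> mat_kernel A"
      using in_own_span[of "set (cols S)"] cols_dim[of S] S by (auto simp: ker)
    moreover have "col S j \<in> set (cols S)" using j S by (auto simp: cols_def)
    ultimately have "A *\<^sub>v col S j = 0\<^sub>v l" using mat_kernelD(2)[OF A] by blast
    then show "col (A * S) j = col (0\<^sub>m l m) j"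
      using j A S by (simp add: mult_mat_vec_def)
  qed (use A S in auto)
  then have AS: "mat_eval \<xi> A * mat_eval \<xi> S = 0\<^sub>m l m"
    using mat_eval_mult[OF A S, of \<xi>] by (simp add: mat_eval_zero)
  show ?thesis
  proof
    show "mat_image (mat_eval \<xi> S) \<subseteq> mat_kernel (mat_eval \<xi> A)"
    proof
      fix v assume "v \<in> mat_image (mat_eval \<xi> S)"
      then obtain y where y: "y \<in> carrier_vec m" "v = mat_eval \<xi> S *\<^sub>v y"
        using S\<xi> by (auto simp: mat_image_def)
      have "mat_eval \<xi> A *\<^sub>v v = 0\<^sub>m l m *\<^sub>v y"
        using assoc_mult_mat_vec[OF A\<xi> S\<xi> y(1)] by (simp add: AS y(2))
      also have "\<dots> = 0\<^sub>v l" using y(1) by (intro eq_vecI) simp_all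
      finally have "mat_eval \<xi> A *\<^sub>v v = 0\<^sub>v l" .
      then show "v \<in> mat_kernel (mat_eval \<xi> A)"
        using y S\<xi> by (auto simp: mat_kernel[OF A\<xi>])
    qed
    show "mat_kernel (mat_eval \<xi> A) \<subseteq> mat_image (mat_eval \<xi> S)"
    proof
      fix v assume v: "v \<in> mat_kernel (mat_eval \<xi> A)"
      have "\<real> \<subseteq> F" using assms(1) by auto
      then obtain u where u: "u \<in> mat_kernel A" "map_vec (poly_eval \<xi>) u = v"
        by (rule kernel_vector_lifts_to_syzygy[OF A _ assms(4,6) v])
      obtain y where y: "y \<in> carrier_vec m" "u = S *\<^sub>v y"
        using span_cols_subset_image[OF S] u(1) ker by blast
      have "v = mat_eval \<xi> S *\<^sub>v map_vec (poly_eval \<xi>) y"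
        using u(2) y S by (simp add: vec_eval_mult)
      then show "v \<in> mat_image (mat_eval \<xi> S)" using y(1) S\<xi> by (auto simp: mat_image_def)
    qed
  qed
qed

end
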